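(* Let $f,f',g,g'$ be multi-valued functions on represented spaces. If $f\leq_{\mathrm W}g$ and $f'\leq_{\mathrm W}g'$, then $f\oplus f'\leq_{\mathrm W}g\oplus g'$. The analogous statement holds for strong Weihrauch reducibility: if $f\leq_{\mathrm{sW}}g$ and $f'\leq_{\mathrm{sW}}g'$, then $f\oplus f'\leq_{\mathrm{sW}}g\oplus g'$.
   Context: A represented space $(X,\delta_X)$ is a set $X$ with a surjective partial map $\delta_X:\subseteq\mathbb{N}^{\mathbb{N}}\to X$. A multi-valued function $f:\subseteq X\rightrightarrows Y$ assigns to each $x$ a set $f(x)\subseteq Y$, with $\mathrm{dom}(f)=\{x: f(x)\neq\emptyset\}$. A realizer of $f$ is a partial $F:\subseteq\mathbb{N}^{\mathbb{N}}\to\mathbb{N}^{\mathbb{N}}$ such that $F(p)$ is defined and $\delta_YF(p)\in f(\delta_X(p))$ whenever $\delta_X(p)\in\mathrm{dom}(f)$. $f\leq_{\mathrm W}g$ iff there are computable $H,K:\subseteq\mathbb{N}^{\mathbb{N}}\to\mathbb{N}^{\mathbb{N}}$ such that for every realizer $G$ of $g$ the function $p\mapsto H\langle p,GK(p)\rangle$ is a realizer of $f$, where $\langle\cdot,\cdot\rangle$ is a computable pairing on $\mathbb{N}^{\mathbb{N}}$. $f\leq_{\mathrm{sW}}g$ is defined in the same way with $H\circ G\circ K$ in place of $p\mapsto H\langle p,GK(p)\rangle$. Direct sum: for $f:\subseteq X\rightrightarrows Y$, $g:\subseteq U\rightrightarrows V$, $f\oplus g:\subseteq X\times U\rightrightarrows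 Y\oplus V$, where $Y\oplus V=(\{0\}\times Y)\cup(\{1\}\times V)$, is $(f\oplus g)(x,u)=(\{0\}\times f(x))\cup(\{1\}\times g(u))$ on $\mathrm{dom}(f)\times\mathrm{dom}(g)$. $X\times U$ carries the representation $[\delta_X,\delta_U]\langle p,q\rangle=(\delta_X(p),\delta_U(q))$. $Y\oplus V$ is represented by: $np$ (the sequence $p$ prefixed by $n\in\mathbb{N}$) names $(0,\delta_Y(p))$ if $n=0$ and $(1,\delta_V(p))$ otherwise. *)

theory Defs
  imports Main
begin

section \<open>Computable partial functions on Baire space\<close>

type_synonym baire = "nat \<Rightarrow> nat"

text \<open>Programs for the functions that are partial recursive relative to an oracle \<open>p \<in> \<nat>\<^sup>\<nat>\<close>.
  Programs act on argument lists; there is no arity discipline, and a basic function that is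
  applied to too short a list is undefined.\<close>

datatype prog =
    Zero
  | Succ
  | Proj nat
  | Oracle
  | Comp prog "prog list"
  | PrimRec prog prog
  | Mu prog

fun eval :: "prog \<Rightarrow> baire \<Rightarrow> nat list \<Rightarrow> nat option" where
  "eval Zero p xs = Some 0"
| "eval Succ p xs = (case xs of [] \<Rightarrow> None | x # _ \<Rightarrow> Some (Suc x))"
| "eval (Proj i) p xs = (if i < length xs then Some (xs ! i) else None)"
| "eval Oracle p xs = (case xs of [] \<Rightarrow> None | x # _ \<Rightarrow> Some (p x))"
| "eval (Comp f gs) p xs =
     Option.bind (those (map (\<lambda>g. eval g p xs) gs)) (\<lambda>ys. eval f p ys)"
| "eval (PrimRec f g) p xs =
     (case xs of
        [] \<Rightarrow> None
      | n # ys \<Rightarrow>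
          rec_nat (eval f p ys) (\<lambda>m r. Option.bind r (\<lambda>z. eval g p (m # z # ys))) n)"
| "eval (Mu f) p xs =
     (if \<exists>n. eval f p (n # xs) = Some 0 \<and> (\<forall>m<n. eval f p (m # xs) \<noteq> None)
      then Some (LEAST n. eval f p (n # xs) = Some 0)
      else None)"

text \<open>As usual in computable analysis, a program computes \<open>F\<close> if it produces \<open>F(p)\<close> digit by digit
  for every \<open>p\<close> in the domain of \<open>F\<close>; nothing is required outside the domain. Hence restrictions
  of computable functions are computable.\<close>

definition computable :: "(baire \<rightharpoonup> baire) \<Rightarrow> bool" where
  "computable F \<longleftrightarrow> (\<exists>e. \<forall>p q. F p = Some q \<longrightarrow> (\<forall>n. eval e p [n] = Some (q n)))"

definition baire_pair :: "baire \<Rightarrow> baire \<Rightarrow> baire" ("\<langle>_, _\<rangle>") where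
  "\<langle>p, q\<rangle> = (\<lambda>n. if even n then p (n div 2) else q (n div 2))"

definition baire_fst :: "baire \<Rightarrow> baire" where
  "baire_fst r = (\<lambda>n. r (2 * n))"

definition baire_snd :: "baire \<Rightarrow> baire" where
  "baire_snd r = (\<lambda>n. r (2 * n + 1))"

lemma baire_fst_pair [simp]: "baire_fst \<langle>p, q\<rangle> = p"
  by (simp add: baire_fst_def baire_pair_def)

lemma baire_snd_pair [simp]: "baire_snd \<langle>p, q\<rangle> = q"
  by (simp add: baire_snd_def baire_pair_def)

lemma baire_pair_fst_snd [simp]: "\<langle>baire_fst r, baire_snd r\<rangle> = r"
  by (rule ext) (auto simp: baire_fst_def baire_snd_def baire_pair_def)


section \<open>Represented spaces\<close>

record 'a repspace =
  points :: "'a set"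
  rep :: "baire \<rightharpoonup> 'a"

definition represented_space :: "'a repspace \<Rightarrow> bool" where
  "represented_space X \<longleftrightarrow> ran (rep X) = points X"

definition prod_space :: "'a repspace \<Rightarrow> 'b repspace \<Rightarrow> ('a \<times> 'b) repspace" where
  "prod_space X U =
     \<lparr>points = points X \<times> points U,
      rep = (\<lambda>r. case (rep X (baire_fst r), rep U (baire_snd r)) of
                   (Some x, Some u) \<Rightarrow> Some (x, u)
                 | _ \<Rightarrow> None)\<rparr>"

definition sum_space :: "'a repspace \<Rightarrow> 'b repspace \<Rightarrow> ('a + 'b) repspace" where
  "sum_space Y V =
     \<lparr>points = points Y <+> points V,
      rep = (\<lambda>r. if r 0 = 0 then map_option Inl (rep Y (\<lambda>n. r (Suc n)))
                 else map_option Inr (rep V (\<lambda>n. r (Suc n))))\<rparr>"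

lemma represented_space_prod:
  assumes "represented_space X" "represented_space U"
  shows "represented_space (prod_space X U)"
proof -
  have "ran (rep (prod_space X U)) = ran (rep X) \<times> ran (rep U)" (is "?L = ?R")
  proof
    show "?L \<subseteq> ?R"
      by (auto simp: prod_space_def ran_def split: option.splits)
    show "?R \<subseteq> ?L"
    proof clarify
      fix x u assume "x \<in> ran (rep X)" "u \<in> ran (rep U)"
      then obtain p q where "rep X p = Some x" "rep U q = Some u"
        by (auto simp: ran_def)
      then have "rep (prod_space X U) \<langle>p, q\<rangle> = Some (x, u)"
        by (simp add: prod_space_def)
      then show "(x, u) \<in> ?L" unfolding ran_def by blast
    qed
  qed
  with assms show ?thesis
    by (simp add: represented_space_def prod_space_def)
qed

lemma represented_space_sum:
  assumes "represented_space Y" "represented_space V"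
  shows "represented_space (sum_space Y V)"
proof -
  have "ran (rep (sum_space Y V)) = ran (rep Y) <+> ran (rep V)" (is "?L = ?R")
  proof
    show "?L \<subseteq> ?R"
      by (auto simp: sum_space_def ran_def split: if_splits)
    show "?R \<subseteq> ?L"
    proof
      fix z assume "z \<in> ?R"
      then consider y p where "z = Inl y" "rep Y p = Some y"
        | v q where "z = Inr v" "rep V q = Some v"
        by (auto simp: ran_def)
      then show "z \<in> ?L"
      proof cases
        case 1
        then have "rep (sum_space Y V) (case_nat 0 p) = Some z"
          by (simp add: sum_space_def)
        then show ?thesis unfolding ran_def by blast
      next
        case 2
        then have "rep (sum_space Y V) (case_nat 1 q) = Some z"
          by (simp add: sum_space_def)
        then show ?thesis unfolding ran_def by blast
      qed
    qed
  qed
  with assms show ?thesis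
    by (simp add: represented_space_def sum_space_def)
qed


section \<open>Multi-valued functions and Weihrauch reducibility\<close>

record ('a, 'b) mvfun =
  source :: "'a repspace"
  target :: "'b repspace"
  image_of :: "'a \<Rightarrow> 'b set"

definition mv_function :: "('a, 'b) mvfun \<Rightarrow> bool" where
  "mv_function f \<longleftrightarrow>
     represented_space (source f) \<and> represented_space (target f) \<and>
     (\<forall>x\<in>points (source f). image_of f x \<subseteq> points (target f)) \<and>
     (\<forall>x. x \<notin> points (source f) \<longrightarrow> image_of f x = {})"

definition mv_dom :: "('a, 'b) mvfun \<Rightarrow> 'a set" where
  "mv_dom f = {x. image_of f x \<noteq> {}}"

definition realizer :: "(baire \<rightharpoonup> baire) \<Rightarrow> ('a, 'b) mvfun \<Rightarrow> bool" where
  "realizer F f \<longleftrightarrow>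
     (\<forall>p x. rep (source f) p = Some x \<and> x \<in> mv_dom f \<longrightarrow>
        (\<exists>q y. F p = Some q \<and> rep (target f) q = Some y \<and> y \<in> image_of f x))"

definition weihrauch_le :: "('a, 'b) mvfun \<Rightarrow> ('c, 'd) mvfun \<Rightarrow> bool" (infix "\<le>\<^sub>W" 50) where
  "f \<le>\<^sub>W g \<longleftrightarrow>
     (\<exists>H K. computable H \<and> computable K \<and>
        (\<forall>G. realizer G g \<longrightarrow>
           realizer (\<lambda>p. Option.bind ((G \<circ>\<^sub>m K) p) (\<lambda>q. H \<langle>p, q\<rangle>)) f))"

definition strong_weihrauch_le :: "('a, 'b) mvfun \<Rightarrow> ('c, 'd) mvfun \<Rightarrow> bool"
    (infix "\<le>\<^sub>s\<^sub>W" 50) where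
  "f \<le>\<^sub>s\<^sub>W g \<longleftrightarrow>
     (\<exists>H K. computable H \<and> computable K \<and>
        (\<forall>G. realizer G g \<longrightarrow> realizer (H \<circ>\<^sub>m (G \<circ>\<^sub>m K)) f))"

text \<open>The case distinction below is essential: \<open>f(x)\<close> and \<open>g(u)\<close> must both be nonempty for
  \<open>(x, u)\<close> to belong to the domain of the direct sum.\<close>

definition mv_sum :: "('a, 'b) mvfun \<Rightarrow> ('c, 'd) mvfun \<Rightarrow> ('a \<times> 'c, 'b + 'd) mvfun"
    (infixl "\<oplus>" 65) where
  "f \<oplus> g =
     \<lparr>source = prod_space (source f) (source g),
      target = sum_space (target f) (target g),
      image_of = (\<lambda>(x, u). if x \<in> mv_dom f \<and> u \<in> mv_dom g
                           then image_of f x <+> image_of g u else {})\<rparr>"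

lemma mv_function_sum:
  assumes "mv_function f" "mv_function g"
  shows "mv_function (f \<oplus> g)"
proof -
  have "represented_space (source (f \<oplus> g))" "represented_space (target (f \<oplus> g))"
    using assms by (simp_all add: mv_function_def mv_sum_def represented_space_prod
        represented_space_sum)
  moreover have "points (source (f \<oplus> g)) = points (source f) \<times> points (source g)"
    "points (target (f \<oplus> g)) = points (target f) <+> points (target g)"
    by (simp_all add: mv_sum_def prod_space_def sum_space_def)
  moreover have "image_of (f \<oplus> g) (x, u) \<subseteq> image_of f x <+> image_of g u" for x u
    by (simp add: mv_sum_def)
  moreover have "image_of (f \<oplus> g) (x, u) = {}" if "image_of f x = {} \<or> image_of g u = {}" for x u
    using that by (auto simp: mv_sum_def mv_dom_def)
  moreover have "image_of f x <+> image_of g u \<subseteq> points (target f) <+> points (target g)"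
    if "x \<in> points (source f)" "u \<in> points (source g)" for x u
    using assms that unfolding mv_function_def by blast
  ultimately show ?thesis
    using assms unfolding mv_function_def by (simp add: split_paired_all) (meson order_trans)
qed

end

theory Submission
  imports Defs
begin

text \<open>Let \<open>H, K\<close> and \<open>H', K'\<close> witness the two given reductions. The pre-processor of the direct
  sum sends \<open>\<langle>p, p'\<rangle>\<close> to \<open>\<langle>K p, K' p'\<rangle>\<close>. The oracle answers with a name \<open>n q\<close> of a solution of one of
  the two summands; the leading digit \<open>n\<close> tells which one, so the post-processor applies \<open>H\<close> or
  \<open>H'\<close> accordingly and prefixes the result with \<open>0\<close> or \<open>1\<close>.

  Two points need an argument. The first is that a realizer of \<open>g \<oplus> g'\<close> does not split into a
  realizer of \<open>g\<close> and one of \<open>g'\<close>: which side is answered may depend on both components of the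
  input. Therefore the quantification over realizers is first replaced by a condition on single
  names (\<open>realizers_iff_pointwise\<close>): \<open>K\<close> maps each name of an instance of \<open>f\<close> to a name of an instance
  of \<open>g\<close>, and the post-processor turns each name of each solution of the latter into a name of a
  solution of the former. In this form two reductions combine side by side
  (\<open>pointwise_reduction_sum\<close>). The pointwise condition follows from the one on realizers by applying
  the latter to a realizer that is undefined at all names on which nothing is required of it, and
  to the realizers that differ from it at one name only.

  The second is computability of the new post-processor. On an answer for the first summand the
  computation of \<open>H'\<close> may diverge, hence the case distinction must be lazy, whereas composition of
  programs is strict. A primitive recursion, however, does not evaluate its step when the recursion
  argument is \<open>0\<close>, and two nested recursions give a lazy conditional (\<open>cond_prog\<close>).
  Composition of computable functions on sequences is obtained by substituting a program for the oracle (\<open>eval_subst_oracle\<close>).\<close>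


section \<open>Closure properties of the computable functions on sequences\<close>

primrec subst_oracle :: "prog \<Rightarrow> prog \<Rightarrow> prog" where
  "subst_oracle s Zero = Zero"
| "subst_oracle s Succ = Succ"
| "subst_oracle s (Proj i) = Proj i"
| "subst_oracle s Oracle = Comp s [Proj 0]"
| "subst_oracle s (Comp f gs) = Comp (subst_oracle s f) (map (subst_oracle s) gs)"
| "subst_oracle s (PrimRec f g) = PrimRec (subst_oracle s f) (subst_oracle s g)"
| "subst_oracle s (Mu f) = Mu (subst_oracle s f)"

text \<open>The hypothesis asks \<open>s\<close> to be correct on one-element lists only; \<open>Comp s [Proj 0]\<close> cuts longer
  lists down to their head and, like \<open>Oracle\<close>, is undefined on the empty list.\<close>

lemma eval_subst_oracle:
  assumes "\<And>n. eval s r [n] = Some (p n)"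
  shows "eval (subst_oracle s e) r xs = eval e p xs"
proof (induction e arbitrary: xs)
  case Oracle
  show ?case using assms by (cases xs) simp_all
next
  case (Comp f gs)
  have "map (\<lambda>g. eval g r xs) (map (subst_oracle s) gs) = map (\<lambda>g. eval g p xs) gs"
    using Comp.IH(2) by simp
  moreover have "eval (subst_oracle s f) r = eval f p"
    using Comp.IH(1) by (rule ext)
  ultimately show ?case
    by (simp only: subst_oracle.simps eval.simps)
qed (simp_all split: list.split)

fun const_prog :: "nat \<Rightarrow> prog" where
  "const_prog 0 = Zero"
| "const_prog (Suc k) = Comp Succ [const_prog k]"

lemma eval_const_prog [simp]: "eval (const_prog k) p xs = Some k"
  by (induction k) simp_all

definition not_prog :: prog where
  "not_prog = PrimRec (const_prog 1) Zero"

lemma eval_not_prog [simp]: "eval not_prog p (n # xs) = Some (if n = 0 then 1 else 0)"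
  by (induction n) (simp_all add: not_prog_def)

lemma rec_nat_ignoring_accumulator:
  "rec_nat a (\<lambda>m r. Option.bind r (\<lambda>_. b)) n = (if n = 0 then a else Option.bind a (\<lambda>_. b))"
proof (induction n)
  case (Suc n)
  then show ?case by (cases a; cases b) auto
qed simp

text \<open>The composition of \<open>guard_prog a\<close> with a test skips \<open>a\<close> when the test yields \<open>0\<close>, because the
  step of a primitive recursion up to \<open>0\<close> is not evaluated.\<close>

definition guard_prog :: "prog \<Rightarrow> prog" where
  "guard_prog a = PrimRec Zero (Comp a [Proj 2])"

lemma eval_guard_prog [simp]:
  "eval (guard_prog a) p [v, n] = (if v = 0 then Some 0 else eval a p [n])"
  by (simp add: guard_prog_def rec_nat_ignoring_accumulator del: One_nat_def)

text \<open>Primitive recursion alone would give a conditional that evaluates its first branch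
  unconditionally, as the base of the recursion; guarding the base by the negated test makes the
  first branch lazy too.\<close>

definition cond_prog :: "prog \<Rightarrow> prog \<Rightarrow> prog \<Rightarrow> prog" where
  "cond_prog c a b =
     Comp (PrimRec (Comp (guard_prog a) [Comp not_prog [c], Proj 0]) (Comp b [Proj 2])) [c, Proj 0]"

lemma eval_cond_prog:
  assumes "eval c p [n] = Some v"
  shows "eval (cond_prog c a b) p [n] = (if v = 0 then eval a p [n] else eval b p [n])"
  using assms by (simp add: cond_prog_def rec_nat_ignoring_accumulator del: One_nat_def)

definition add_prog :: prog where
  "add_prog = PrimRec (Proj 0) (Comp Succ [Proj 1])"

lemma eval_add_prog [simp]: "eval add_prog p [m, n] = Some (m + n)"
  by (induction m) (simp_all add: add_prog_def)

definition double_prog :: prog where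
  "double_prog = Comp add_prog [Proj 0, Proj 0]"

lemma eval_double_prog [simp]: "eval double_prog p [n] = Some (2 * n)"
  by (simp add: double_prog_def)

definition pred_prog :: prog where
  "pred_prog = PrimRec Zero (Proj 0)"

lemma eval_pred_prog [simp]: "eval pred_prog p [n] = Some (n - 1)"
  by (induction n) (simp_all add: pred_prog_def)

definition parity_prog :: prog where
  "parity_prog = PrimRec Zero (Comp not_prog [Proj 1])"

lemma eval_parity_prog [simp]: "eval parity_prog p [n] = Some (n mod 2)"
proof (induction n)
  case (Suc n)
  then show ?case by (simp add: parity_prog_def mod_Suc)
qed (simp add: parity_prog_def)

text \<open>The recursion is \<open>Suc n div 2 = n mod 2 + n div 2\<close>.\<close>

definition half_prog :: prog where
  "half_prog = PrimRec Zero (Comp add_prog [Comp parity_prog [Proj 0], Proj 1])"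

lemma eval_half_prog [simp]: "eval half_prog p [n] = Some (n div 2)"
proof (induction n)
  case (Suc n)
  moreover have "Suc n div 2 = n mod 2 + n div 2" by presburger
  ultimately show ?case by (simp add: half_prog_def)
qed (simp add: half_prog_def)

lemma computable_comp:
  assumes "computable F" "computable G"
  shows "computable (F \<circ>\<^sub>m G)"
proof -
  obtain e d where e: "\<And>p q n. F p = Some q \<Longrightarrow> eval e p [n] = Some (q n)"
    and d: "\<And>p q n. G p = Some q \<Longrightarrow> eval d p [n] = Some (q n)"
    using assms unfolding computable_def by metis
  have "eval (subst_oracle d e) p [n] = Some (q n)" if FG: "(F \<circ>\<^sub>m G) p = Some q" for p q n
  proof -
    obtain r where "G p = Some r" "F r = Some q"
      using FG by (auto simp: map_comp_Some_iff)
    then show ?thesis using d e by (simp add: eval_subst_oracle)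
  qed
  then show ?thesis unfolding computable_def by blast
qed

lemma computable_total_comp:
  assumes "computable F" "computable (\<lambda>p. Some (\<phi> p))"
  shows "computable (\<lambda>p. F (\<phi> p))"
  using computable_comp[OF assms] by (simp add: map_comp_def)

lemma computable_reindex:
  assumes "\<And>p n. eval a p [n] = Some (\<phi> n)"
  shows "computable (\<lambda>p. Some (\<lambda>n. p (\<phi> n)))"
  unfolding computable_def by (rule exI[of _ "Comp Oracle [a]"]) (auto simp: assms)

lemma computable_fst: "computable (\<lambda>r. Some (baire_fst r))"
  unfolding baire_fst_def by (rule computable_reindex[of double_prog]) simp

lemma computable_snd: "computable (\<lambda>r. Some (baire_snd r))"
  unfolding baire_snd_def by (rule computable_reindex[of "Comp Succ [double_prog]"]) simp

definition baire_tail :: "baire \<Rightarrow> baire" where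
  "baire_tail r = (\<lambda>n. r (Suc n))"

lemma baire_tail_prefix [simp]: "baire_tail (case_nat k q) = q"
  by (simp add: baire_tail_def)

lemma computable_tail: "computable (\<lambda>r. Some (baire_tail r))"
  unfolding baire_tail_def by (rule computable_reindex[of Succ]) simp

lemma computable_prefix: "computable (\<lambda>q. Some (case_nat k q))"
proof -
  have "eval (cond_prog (Proj 0) (const_prog k) (Comp Oracle [pred_prog])) q [n]
      = Some (case_nat k q n)" for q n
    by (cases n) (simp_all add: eval_cond_prog)
  then show ?thesis unfolding computable_def by blast
qed

lemma computable_pair:
  assumes "computable F" "computable G"
  shows "computable (\<lambda>p. Option.bind (F p) (\<lambda>a. map_option (\<lambda>b. \<langle>a, b\<rangle>) (G p)))"
proof -
  obtain e d where e: "\<And>p q n. F p = Some q \<Longrightarrow> eval e p [n] = Some (q n)"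
    and d: "\<And>p q n. G p = Some q \<Longrightarrow> eval d p [n] = Some (q n)"
    using assms unfolding computable_def by metis
  let ?c = "cond_prog parity_prog (Comp e [half_prog]) (Comp d [half_prog])"
  have "eval ?c p [n] = Some (q n)"
    if FG: "Option.bind (F p) (\<lambda>a. map_option (\<lambda>b. \<langle>a, b\<rangle>) (G p)) = Some q" for p q n
  proof -
    obtain a b where "F p = Some a" "G p = Some b" "q = \<langle>a, b\<rangle>"
      using FG by (auto simp: bind_eq_Some_conv)
    then show ?thesis
      using e d by (simp add: eval_cond_prog baire_pair_def even_iff_mod_2_eq_zero)
  qed
  then show ?thesis unfolding computable_def by blast
qed

lemma computable_total_pair:
  assumes "computable (\<lambda>p. Some (\<phi> p))" "computable (\<lambda>p. Some (\<psi> p))"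
  shows "computable (\<lambda>p. Some \<langle>\<phi> p, \<psi> p\<rangle>)"
  using computable_pair[OF assms] by simp

lemma computable_if_digit:
  assumes "computable F" "computable G"
  shows "computable (\<lambda>r. if r k = 0 then F r else G r)"
proof -
  obtain e d where e: "\<And>p q n. F p = Some q \<Longrightarrow> eval e p [n] = Some (q n)"
    and d: "\<And>p q n. G p = Some q \<Longrightarrow> eval d p [n] = Some (q n)"
    using assms unfolding computable_def by metis
  have "eval (cond_prog (Comp Oracle [const_prog k]) e d) r [n] = Some (q n)"
    if "(if r k = 0 then F r else G r) = Some q" for r q n
    using that e d by (simp add: eval_cond_prog split: if_splits)
  then show ?thesis unfolding computable_def by blast
qed

lemma computable_map_prefix:
  assumes "computable F"
  shows "computable (\<lambda>p. map_option (case_nat k) (F p))"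
  using computable_comp[OF computable_prefix[of k] assms]
  by (simp add: map_comp_def map_option_case)


section \<open>Reductions as pointwise conditions on names\<close>

definition names :: "'a repspace \<Rightarrow> 'a set \<Rightarrow> baire set" where
  "names X S = {p. \<exists>x\<in>S. rep X p = Some x}"

lemma realizer_iff_names:
  "realizer F f \<longleftrightarrow>
     (\<forall>p x. rep (source f) p = Some x \<and> x \<in> mv_dom f \<longrightarrow>
        (\<exists>q\<in>names (target f) (image_of f x). F p = Some q))"
  unfolding realizer_def names_def by blast

text \<open>The post-processor \<open>J\<close> takes the original name and the answer as separate arguments, so that
  one notion covers both reducibilities: \<open>J p q = H \<langle>p, q\<rangle>\<close> for the ordinary one, \<open>J p q = H q\<close> for
  the strong one.\<close>

definition pointwise_reduction ::
  "('a, 'b) mvfun \<Rightarrow> ('c, 'd) mvfun \<Rightarrow> (baire \<rightharpoonup> baire) \<Rightarrow> (baire \<Rightarrow> baire \<rightharpoonup> baire) \<Rightarrow> bool" where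
  "pointwise_reduction f g K J \<longleftrightarrow>
     (\<forall>p x. rep (source f) p = Some x \<and> x \<in> mv_dom f \<longrightarrow>
        (\<exists>k z. K p = Some k \<and> rep (source g) k = Some z \<and> z \<in> mv_dom g \<and>
           (\<forall>q\<in>names (target g) (image_of g z).
              \<exists>q'\<in>names (target f) (image_of f x). J p q = Some q')))"

lemma names_image_nonempty:
  assumes "mv_function g" "rep (source g) k = Some z" "z \<in> mv_dom g"
  shows "names (target g) (image_of g z) \<noteq> {}"
proof -
  obtain y where "y \<in> image_of g z"
    using assms(3) by (auto simp: mv_dom_def)
  moreover from this have "y \<in> ran (rep (target g))"
    using assms(1) unfolding mv_function_def represented_space_def by blast
  ultimately show ?thesis unfolding names_def ran_def by blast
qed

text \<open>A realizer may be undefined at every name on which nothing is required of it. Feeding such a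
  minimal realizer to a reduction of \<open>f\<close> to \<open>g\<close> shows that \<open>K\<close> maps names of instances of \<open>f\<close> to names
  of instances of \<open>g\<close>. Surjectivity of the target representation provides the values.\<close>

lemma minimal_realizer_exists:
  assumes "mv_function g"
  shows "\<exists>G. realizer G g \<and> (\<forall>k\<in>dom G. \<exists>z\<in>mv_dom g. rep (source g) k = Some z)"
proof -
  let ?I = "\<lambda>k. \<exists>z\<in>mv_dom g. rep (source g) k = Some z"
  let ?G = "\<lambda>k. if ?I k
    then Some (SOME q. q \<in> names (target g) (image_of g (the (rep (source g) k)))) else None"
  have "realizer ?G g"
    unfolding realizer_iff_names
    using names_image_nonempty[OF assms] by (auto simp: some_in_eq)
  moreover have "\<forall>k\<in>dom ?G. ?I k"
    by (simp add: dom_def)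
  ultimately show ?thesis by blast
qed

text \<open>For the forward direction, a minimal realizer \<open>G\<close> identifies \<open>k = K p\<close> as a name of an instance of
  \<open>g\<close>; changing \<open>G\<close> at \<open>k\<close> to an arbitrary solution name keeps it a realizer, so the post-processor
  must be correct on all solution names.\<close>

lemma realizers_iff_pointwise:
  assumes "mv_function g"
  shows "(\<forall>G. realizer G g \<longrightarrow> realizer (\<lambda>p. Option.bind ((G \<circ>\<^sub>m K) p) (J p)) f) \<longleftrightarrow>
    pointwise_reduction f g K J"
proof
  assume red: "\<forall>G. realizer G g \<longrightarrow> realizer (\<lambda>p. Option.bind ((G \<circ>\<^sub>m K) p) (J p)) f"
  obtain G where G: "realizer G g"
    and minimal: "\<And>k. k \<in> dom G \<Longrightarrow> \<exists>z\<in>mv_dom g. rep (source g) k = Some z"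
    using minimal_realizer_exists[OF assms] by blast
  show "pointwise_reduction f g K J"
    unfolding pointwise_reduction_def
  proof (intro allI impI)
    fix p x assume px: "rep (source f) p = Some x \<and> x \<in> mv_dom f"
    obtain b where "Option.bind ((G \<circ>\<^sub>m K) p) (J p) = Some b"
      using red[rule_format, OF G] px unfolding realizer_iff_names by blast
    then obtain k where k: "K p = Some k" "k \<in> dom G"
      by (auto simp: bind_eq_Some_conv map_comp_Some_iff)
    then obtain z where z: "z \<in> mv_dom g" "rep (source g) k = Some z"
      using minimal by blast
    have "\<exists>q'\<in>names (target f) (image_of f x). J p q = Some q'"
      if q: "q \<in> names (target g) (image_of g z)" for q
    proof -
      \<comment> \<open>every solution name \<open>q\<close> is the answer of some realizer at \<open>k\<close>\<close>
      have "realizer (G(k \<mapsto> q)) g"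
        using G q z unfolding realizer_iff_names by auto
      then have "realizer (\<lambda>p. Option.bind ((G(k \<mapsto> q) \<circ>\<^sub>m K) p) (J p)) f"
        using red by blast
      then obtain q' where "q' \<in> names (target f) (image_of f x)"
        and "Option.bind ((G(k \<mapsto> q) \<circ>\<^sub>m K) p) (J p) = Some q'"
        using px unfolding realizer_iff_names by blast
      then show ?thesis
        using k by auto
    qed
    then show "\<exists>k z. K p = Some k \<and> rep (source g) k = Some z \<and> z \<in> mv_dom g \<and>
        (\<forall>q\<in>names (target g) (image_of g z).
           \<exists>q'\<in>names (target f) (image_of f x). J p q = Some q')"
      using k z by blast
  qed
next
  assume pw: "pointwise_reduction f g K J"
  show "\<forall>G. realizer G g \<longrightarrow> realizer (\<lambda>p. Option.bind ((G \<circ>\<^sub>m K) p) (J p)) f"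
  proof (intro allI impI)
    fix G assume G: "realizer G g"
    show "realizer (\<lambda>p. Option.bind ((G \<circ>\<^sub>m K) p) (J p)) f"
      unfolding realizer_iff_names
    proof (intro allI impI)
      fix p x assume "rep (source f) p = Some x \<and> x \<in> mv_dom f"
      then obtain k z where k: "K p = Some k"
        and z: "rep (source g) k = Some z" "z \<in> mv_dom g"
        and J: "\<forall>q\<in>names (target g) (image_of g z).
          \<exists>q'\<in>names (target f) (image_of f x). J p q = Some q'"
        using pw unfolding pointwise_reduction_def by blast
      obtain q where "q \<in> names (target g) (image_of g z)" "G k = Some q"
        using G z unfolding realizer_iff_names by blast
      then show "\<exists>q\<in>names (target f) (image_of f x). Option.bind ((G \<circ>\<^sub>m K) p) (J p) = Some q"
        using J k by simp
    qed
  qed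
qed

lemma weihrauch_le_iff_pointwise:
  assumes "mv_function g"
  shows "f \<le>\<^sub>W g \<longleftrightarrow>
    (\<exists>H K. computable H \<and> computable K \<and> pointwise_reduction f g K (\<lambda>p q. H \<langle>p, q\<rangle>))"
  unfolding weihrauch_le_def
  by (simp only: realizers_iff_pointwise[OF assms, where J = "\<lambda>p q. H \<langle>p, q\<rangle>" for H])

lemma strong_weihrauch_le_iff_pointwise:
  assumes "mv_function g"
  shows "f \<le>\<^sub>s\<^sub>W g \<longleftrightarrow>
    (\<exists>H K. computable H \<and> computable K \<and> pointwise_reduction f g K (\<lambda>p. H))"
proof -
  have "H \<circ>\<^sub>m (G \<circ>\<^sub>m K) = (\<lambda>p. Option.bind ((G \<circ>\<^sub>m K) p) H)" for H G K :: "baire \<rightharpoonup> baire"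
    by (rule ext) (simp add: map_comp_def split: option.split)
  then show ?thesis
    unfolding strong_weihrauch_le_def
    by (simp only: realizers_iff_pointwise[OF assms, where J = "\<lambda>p. H" for H])
qed


section \<open>Direct sums of reductions\<close>

definition sum_pre :: "(baire \<rightharpoonup> baire) \<Rightarrow> (baire \<rightharpoonup> baire) \<Rightarrow> baire \<rightharpoonup> baire" where
  "sum_pre K K' r =
     Option.bind (K (baire_fst r)) (\<lambda>k. map_option (\<lambda>k'. \<langle>k, k'\<rangle>) (K' (baire_snd r)))"

definition sum_post ::
  "(baire \<Rightarrow> baire \<rightharpoonup> baire) \<Rightarrow> (baire \<Rightarrow> baire \<rightharpoonup> baire) \<Rightarrow> baire \<Rightarrow> baire \<rightharpoonup> baire" where
  "sum_post J J' r q =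
     (if q 0 = 0 then map_option (case_nat 0) (J (baire_fst r) (baire_tail q))
      else map_option (case_nat 1) (J' (baire_snd r) (baire_tail q)))"

lemma computable_sum_pre:
  assumes "computable K" "computable K'"
  shows "computable (sum_pre K K')"
  unfolding sum_pre_def
  by (intro computable_pair computable_total_comp[OF assms(1) computable_fst]
      computable_total_comp[OF assms(2) computable_snd])

lemma computable_sum_post_strong:
  assumes "computable H" "computable H'"
  shows "computable (sum_post (\<lambda>p. H) (\<lambda>p. H') r)"
  unfolding sum_post_def
  by (intro computable_if_digit computable_map_prefix
      computable_total_comp[OF _ computable_tail] assms)

lemma computable_sum_post:
  assumes "computable H" "computable H'"
  shows "computable (\<lambda>s. sum_post (\<lambda>p q. H \<langle>p, q\<rangle>) (\<lambda>p q. H' \<langle>p, q\<rangle>) (baire_fst s) (baire_snd s))"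
proof -
  have tail_snd: "computable (\<lambda>s. Some (baire_tail (baire_snd s)))"
    by (rule computable_total_comp[OF computable_tail computable_snd])
  have fst_fst: "computable (\<lambda>s. Some (baire_fst (baire_fst s)))"
    and snd_fst: "computable (\<lambda>s. Some (baire_snd (baire_fst s)))"
    by (rule computable_total_comp[OF _ computable_fst], rule computable_fst computable_snd)+
  \<comment> \<open>the leading digit of the second component of a pair is the digit of the pair at position 1\<close>
  have digit: "baire_snd s 0 = s 1" for s
    by (simp add: baire_snd_def)
  show ?thesis
    unfolding sum_post_def digit
    by (intro computable_if_digit computable_map_prefix
        computable_total_comp[OF assms(1) computable_total_pair[OF fst_fst tail_snd]]
        computable_total_comp[OF assms(2) computable_total_pair[OF snd_fst tail_snd]])
qed

lemma rep_source_sum: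
  "rep (source (f \<oplus> f')) r = Some (x, x') \<longleftrightarrow>
     rep (source f) (baire_fst r) = Some x \<and> rep (source f') (baire_snd r) = Some x'"
  by (auto simp: mv_sum_def prod_space_def split: option.splits)

lemma mv_dom_sum: "(x, x') \<in> mv_dom (f \<oplus> f') \<longleftrightarrow> x \<in> mv_dom f \<and> x' \<in> mv_dom f'"
  by (auto simp: mv_dom_def mv_sum_def)

lemma names_target_sum:
  assumes "x \<in> mv_dom f" "x' \<in> mv_dom f'"
  shows "q \<in> names (target (f \<oplus> f')) (image_of (f \<oplus> f') (x, x')) \<longleftrightarrow>
    (if q 0 = 0 then baire_tail q \<in> names (target f) (image_of f x)
     else baire_tail q \<in> names (target f') (image_of f' x'))"
  using assms by (auto simp: names_def mv_sum_def sum_space_def baire_tail_def)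

text \<open>Both summands of the source must be transformed, since \<open>(z, z')\<close> is an instance of \<open>g \<oplus> g'\<close> only
  if both components are instances; of the two post-processors only the one selected by the tag
  of the answer is sure to be correct on it.\<close>

lemma pointwise_reduction_sum:
  assumes "pointwise_reduction f g K J" "pointwise_reduction f' g' K' J'"
  shows "pointwise_reduction (f \<oplus> f') (g \<oplus> g') (sum_pre K K') (sum_post J J')"
  unfolding pointwise_reduction_def
proof (intro allI impI)
  fix r w assume rw: "rep (source (f \<oplus> f')) r = Some w \<and> w \<in> mv_dom (f \<oplus> f')"
  obtain x x' where w: "w = (x, x')" by (cases w)
  let ?p = "baire_fst r" and ?p' = "baire_snd r"
  have dom: "x \<in> mv_dom f" "x' \<in> mv_dom f'"
    and name: "rep (source f) ?p = Some x" "rep (source f') ?p' = Some x'"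
    using rw by (simp_all add: w rep_source_sum mv_dom_sum)
  obtain k z where k: "K ?p = Some k" "rep (source g) k = Some z" "z \<in> mv_dom g"
    and J: "\<And>q. q \<in> names (target g) (image_of g z) \<Longrightarrow>
      \<exists>a\<in>names (target f) (image_of f x). J ?p q = Some a"
    using assms(1) dom name unfolding pointwise_reduction_def by blast
  obtain k' z' where k': "K' ?p' = Some k'" "rep (source g') k' = Some z'" "z' \<in> mv_dom g'"
    and J': "\<And>q. q \<in> names (target g') (image_of g' z') \<Longrightarrow>
      \<exists>a\<in>names (target f') (image_of f' x'). J' ?p' q = Some a"
    using assms(2) dom name unfolding pointwise_reduction_def by blast
  have "\<exists>a\<in>names (target (f \<oplus> f')) (image_of (f \<oplus> f') (x, x')). sum_post J J' r q = Some a"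
    if q: "q \<in> names (target (g \<oplus> g')) (image_of (g \<oplus> g') (z, z'))" for q
  proof (cases "q 0 = 0")
    case True
    then obtain a where "a \<in> names (target f) (image_of f x)" "J ?p (baire_tail q) = Some a"
      using J q k k' by (auto simp: names_target_sum)
    with True show ?thesis
      by (intro bexI[of _ "case_nat 0 a"]) (simp_all add: names_target_sum dom sum_post_def)
  next
    case False
    then obtain a where "a \<in> names (target f') (image_of f' x')" "J' ?p' (baire_tail q) = Some a"
      using J' q k k' by (auto simp: names_target_sum)
    with False show ?thesis
      by (intro bexI[of _ "case_nat 1 a"]) (simp_all add: names_target_sum dom sum_post_def)
  qed
  moreover have "sum_pre K K' r = Some \<langle>k, k'\<rangle>"
    using k k' by (simp add: sum_pre_def)
  moreover have "rep (source (g \<oplus> g')) \<langle>k, k'\<rangle> = Some (z, z')" "(z, z') \<in> mv_dom (g \<oplus> g')"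
    using k k' by (simp_all add: rep_source_sum mv_dom_sum)
  ultimately show "\<exists>k z. sum_pre K K' r = Some k \<and> rep (source (g \<oplus> g')) k = Some z \<and>
      z \<in> mv_dom (g \<oplus> g') \<and>
      (\<forall>q\<in>names (target (g \<oplus> g')) (image_of (g \<oplus> g') z).
         \<exists>a\<in>names (target (f \<oplus> f')) (image_of (f \<oplus> f') w). sum_post J J' r q = Some a)"
    unfolding w by blast
qed

lemma weihrauch_le_sum:
  assumes "mv_function g" "mv_function g'" "f \<le>\<^sub>W g" "f' \<le>\<^sub>W g'"
  shows "f \<oplus> f' \<le>\<^sub>W g \<oplus> g'"
proof -
  obtain H K H' K' where comp: "computable H" "computable K" "computable H'" "computable K'"
    and pw: "pointwise_reduction f g K (\<lambda>p q. H \<langle>p, q\<rangle>)"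
      "pointwise_reduction f' g' K' (\<lambda>p q. H' \<langle>p, q\<rangle>)"
    using assms by (auto simp: weihrauch_le_iff_pointwise)
  let ?J = "sum_post (\<lambda>p q. H \<langle>p, q\<rangle>) (\<lambda>p q. H' \<langle>p, q\<rangle>)"
  show ?thesis
    unfolding weihrauch_le_iff_pointwise[OF mv_function_sum[OF assms(1,2)]]
  proof (intro exI conjI)
    show "computable (\<lambda>s. ?J (baire_fst s) (baire_snd s))"
      by (rule computable_sum_post[OF comp(1,3)])
    show "computable (sum_pre K K')"
      by (rule computable_sum_pre[OF comp(2,4)])
    show "pointwise_reduction (f \<oplus> f') (g \<oplus> g') (sum_pre K K')
        (\<lambda>p q. ?J (baire_fst \<langle>p, q\<rangle>) (baire_snd \<langle>p, q\<rangle>))"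
      using pointwise_reduction_sum[OF pw] by simp
  qed
qed

lemma strong_weihrauch_le_sum:
  assumes "mv_function g" "mv_function g'" "f \<le>\<^sub>s\<^sub>W g" "f' \<le>\<^sub>s\<^sub>W g'"
  shows "f \<oplus> f' \<le>\<^sub>s\<^sub>W g \<oplus> g'"
proof -
  obtain H K H' K' where comp: "computable H" "computable K" "computable H'" "computable K'"
    and pw: "pointwise_reduction f g K (\<lambda>p. H)" "pointwise_reduction f' g' K' (\<lambda>p. H')"
    using assms by (auto simp: strong_weihrauch_le_iff_pointwise)
  let ?J = "sum_post (\<lambda>p. H) (\<lambda>p. H')"
  \<comment> \<open>without access to the original name in \<open>H\<close> and \<open>H'\<close>, the first argument of the
    post-processor is a dummy and may be fixed\<close>
  have "?J = (\<lambda>p. ?J undefined)"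
    by (intro ext) (simp add: sum_post_def)
  then have "pointwise_reduction (f \<oplus> f') (g \<oplus> g') (sum_pre K K') (\<lambda>p. ?J undefined)"
    using pointwise_reduction_sum[OF pw] by simp
  moreover have "computable (?J undefined)"
    by (rule computable_sum_post_strong[OF comp(1,3)])
  moreover have "computable (sum_pre K K')"
    by (rule computable_sum_pre[OF comp(2,4)])
  ultimately show ?thesis
    unfolding strong_weihrauch_le_iff_pointwise[OF mv_function_sum[OF assms(1,2)]]
    by (intro exI conjI)
qed

theorem proposition3p10:
  fixes f :: "('a, 'b) mvfun" and g :: "('c, 'd) mvfun"
    and f' :: "('e, 'f) mvfun" and g' :: "('g, 'h) mvfun"
  assumes "mv_function f" and "mv_function g" and "mv_function f'" and "mv_function g'"
  shows "(f \<le>\<^sub>W g \<and> f' \<le>\<^sub>W g' \<longrightarrow> f \<oplus> f' \<le>\<^sub>W g \<oplus> g') \<and>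
         (f \<le>\<^sub>s\<^sub>W g \<and> f' \<le>\<^sub>s\<^sub>W g' \<longrightarrow> f \<oplus> f' \<le>\<^sub>s\<^sub>W g \<oplus> g')"
  using assms weihrauch_le_sum strong_weihrauch_le_sum by blast

end
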